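(* Let $n$ be a positive integer and let $k,a$ be complex numbers with $a\neq 0$, $k\neq-1$, such that all the functions below are defined. Then $$-\sum _{p=0}^{n-1} \left(-i 2^{-p}\right)^k \left(\zeta \left(-k,\frac{\pi +3 i 2^p \log (a)}{6 \pi }\right)+\zeta \left(-k,\frac{1}{6} \left(5+\frac{3 i 2^p \log (a)}{\pi }\right)\right)\right)$$ $$=e^{-\frac{1}{2} i k \pi } \left(\zeta \left(-k,\frac{1}{3}+\frac{i \log (a)}{2 \pi }\right)+\zeta \left(-k,\frac{2}{3}+\frac{i \log (a)}{2 \pi }\right)\right)$$ $$-\left(-i 2^{-n}\right)^k \left(\zeta \left(-k,\frac{1}{6} \left(2+\frac{3 i 2^n \log (a)}{\pi }\right)\right)+\zeta \left(-k,\frac{1}{6} \left(4+\frac{3 i 2^n \log (a)}{\pi }\right)\right)\right).$$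
   Context: $\zeta(s,v)$ is the Hurwitz zeta function, $\zeta(s,v)=\sum_{j=0}^\infty (j+v)^{-s}$ for $\operatorname{Re}s>1$, $v\notin\{0,-1,-2,\dots\}$, continued analytically in $s$ to $\mathbb{C}\setminus\{1\}$. Logarithms and powers are principal values. *)

theory Defs
  imports "HOL-Complex_Analysis.Complex_Analysis"
begin

text \<open>
  The value at \<open>s\<close> of the analytic continuation, in the first argument, of the series
  \<open>\<Sum>j. (j + v) powr (-s)\<close> from \<open>Re s > 1\<close> to the plane without 1. The choice operator is applied
  to the value rather than to the function because the continuation is not determined at 1.
  The definition is meaningful for \<open>s \<noteq> 1\<close> and \<open>v\<close> not a nonpositive integer.
\<close>
definition hurwitz_zeta :: "complex \<Rightarrow> complex \<Rightarrow> complex" where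
  "hurwitz_zeta s v = (THE z. \<exists>f. f holomorphic_on (- {1}) \<and>
     (\<forall>w. Re w > 1 \<longrightarrow> (\<lambda>j. (of_nat j + v) powr (- w)) sums f w) \<and> z = f s)"

lemma hurwitz_zeta_eqI:
  assumes hol: "f holomorphic_on (- {1})"
    and ser: "\<And>w. Re w > 1 \<Longrightarrow> (\<lambda>j. (of_nat j + v) powr (- w)) sums f w"
    and s: "s \<noteq> 1"
  shows "hurwitz_zeta s v = f s"
  unfolding hurwitz_zeta_def
proof (rule the_equality)
  show "\<exists>g. g holomorphic_on (- {1}) \<and>
     (\<forall>w. Re w > 1 \<longrightarrow> (\<lambda>j. (of_nat j + v) powr (- w)) sums g w) \<and> f s = g s"
    using hol ser by blast
next
  fix z
  assume "\<exists>g. g holomorphic_on (- {1}) \<and>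
     (\<forall>w. Re w > 1 \<longrightarrow> (\<lambda>j. (of_nat j + v) powr (- w)) sums g w) \<and> z = g s"
  then obtain g where g: "g holomorphic_on (- {1})"
     "\<And>w. Re w > 1 \<Longrightarrow> (\<lambda>j. (of_nat j + v) powr (- w)) sums g w" "z = g s"
    by blast
  have eq: "g w = f w" if "w \<in> {w. Re w > 1}" for w
    using g(2)[of w] ser[of w] that sums_unique2 by blast
  have conn: "connected (- {1 :: complex})"
    by (rule connected_punctured_universe) simp
  have "g s = f s"
  proof (rule analytic_continuation_open[where f = g and g = f and s = "{w. Re w > 1}" and s' = "- {1}"])
    show "open {w. Re w > 1}" by (rule open_halfspace_Re_gt)
    show "{w. Re w > 1} \<noteq> {}" by (auto intro!: exI[of _ "2 :: complex"])
  qed (use conn hol g(1) eq s in auto)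
  then show "z = f s" using g(3) by simp
qed

end

theory Submission
  imports Defs
begin

text \<open>
  The identity is the duplication formula
  \<open>\<zeta>(s, v/2) + \<zeta>(s, (v + 1)/2) = 2\<^sup>s \<zeta>(s, v)\<close>,
  summed by telescoping. Put \<open>s = -k\<close>, \<open>x\<^sub>p = 2\<^sup>p i log a / (2 \<pi>)\<close> and let \<open>G\<^sub>p\<close> and \<open>H\<^sub>p\<close> be
  the sums of \<open>\<zeta>(s, \<cdot>)\<close> over the points \<open>1/3 + x\<^sub>p\<close>, \<open>2/3 + x\<^sub>p\<close> and \<open>1/6 + x\<^sub>p\<close>, \<open>5/6 + x\<^sub>p\<close>.
  The halves of \<open>1/3 + x\<^sub>p\<^sub>+\<^sub>1\<close> and \<open>2/3 + x\<^sub>p\<^sub>+\<^sub>1\<close>, and these halves shifted by \<open>1/2\<close>, are exactly the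
  four points \<open>1/6 + x\<^sub>p\<close>, \<open>2/3 + x\<^sub>p\<close>, \<open>1/3 + x\<^sub>p\<close>, \<open>5/6 + x\<^sub>p\<close>. Hence \<open>G\<^sub>p + H\<^sub>p\<close> is
  \<open>2\<^sup>s\<close> times the sum \<open>G\<close> for the index \<open>p + 1\<close>, and after weighting by \<open>(-i 2\<^sup>-\<^sup>p)\<^sup>k\<close> the term
  \<open>H\<^sub>p\<close> becomes a difference of consecutive weighted \<open>G\<close>'s.

  For \<open>Re s > 1\<close> the duplication formula only sorts the series by the parity of the index, and the
  identity theorem carries it to all \<open>s \<noteq> 1\<close>, provided that the continuation of the series exists
  for every complex \<open>v\<close>. That existence is the bulk of the work. For \<open>Re v \<ge> 1\<close>, with \<open>Z\<close> the
  series, Taylor's formula for \<open>(z + 1)\<^sup>1\<^sup>-\<^sup>s\<close> at \<open>z = j + v\<close>, summed over \<open>j\<close>, expresses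
  \<open>g(s) = (s - 1) Z(s)\<close> by the values \<open>g(s + 1), \<dots>, g(s + M)\<close>, the entire function
  \<open>v\<^sup>1\<^sup>-\<^sup>s\<close> and a series of remainders that converges for \<open>Re s > -M\<close>
  (lemma \<open>hurwitz_series_recurrence\<close>). So \<open>g\<close> extends from each half-plane
  to the next one, one unit further to the left, and is entire. A general \<open>v\<close> differs from one with
  \<open>Re v \<ge> 1\<close> by finitely many terms of the series, each entire in \<open>s\<close>.
\<close>

section \<open>Series of complex powers dominated on a half-plane\<close>

lemma norm_powr_right_halfplane_le:
  fixes u b :: complex
  assumes "1 \<le> t" "t \<le> Re u" "Re b \<le> 0"
  shows "norm (u powr b) \<le> t powr Re b * exp (pi * \<bar>Im b\<bar>)"
proof -
  have tu: "t \<le> norm u"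
    using assms(2) complex_Re_le_cmod order_trans by blast
  have "- Im b * Arg u \<le> \<bar>Im b\<bar> * \<bar>Arg u\<bar>"
    by (metis abs_ge_self abs_minus_cancel abs_mult)
  also have "\<dots> \<le> \<bar>Im b\<bar> * pi"
    using Arg_bounded[of u] by (intro mult_left_mono) auto
  finally have "exp (- Im b * Arg u) \<le> exp (pi * \<bar>Im b\<bar>)"
    by (simp add: mult.commute)
  moreover have "norm u powr Re b \<le> t powr Re b"
    using tu assms by (intro powr_mono2') auto
  ultimately show ?thesis
    unfolding norm_powr_complex by (intro mult_mono) auto
qed

text \<open>
  A Weierstrass test whose bound may vary with \<open>s\<close>: near a point the exponent stays below \<open>-1\<close> by a
  fixed amount and the continuous factor \<open>C\<close> is bounded, which gives one summable majorant on a
  small ball. It serves both the defining series and the series of Taylor remainders.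
\<close>
lemma holomorphic_dominated_series:
  fixes f :: "nat \<Rightarrow> complex \<Rightarrow> complex" and C :: "complex \<Rightarrow> real"
  assumes hol: "\<And>j. f j holomorphic_on {s. Re s > c}"
    and C: "continuous_on UNIV C"
    and bound: "\<And>j s. Re s > c \<Longrightarrow> norm (f j s) \<le> C s * (real j + 1) powr (- (Re s - c + 1))"
  shows "(\<lambda>s. \<Sum>j. f j s) holomorphic_on {s. Re s > c}"
    and "Re s > c \<Longrightarrow> summable (\<lambda>j. f j s)"
proof -
  let ?S = "{s. Re s > c}"
  have S: "open ?S" by (rule open_halfspace_Re_gt)
  obtain g where g: "\<forall>x\<in>?S. (\<lambda>n. f n x) sums g x \<and> g field_differentiable (at x)"
  proof (rule series_differentiable_comparison_complex[OF S, of f])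
    show "f j field_differentiable (at x)" if "x \<in> ?S" for j x
      using holomorphic_on_imp_differentiable_at[OF hol S that] .
    show "\<exists>d h. 0 < d \<and> summable h \<and> range h \<subseteq> \<real>\<^sub>\<ge>\<^sub>0 \<and>
        (\<forall>\<^sub>F n in sequentially. \<forall>y\<in>ball x d \<inter> ?S. cmod (f n y) \<le> cmod (h n))"
      if x: "x \<in> ?S" for x
    proof -
      \<comment> \<open>Half the distance to the boundary: on the ball the exponent stays at most \<open>-(d + 1)\<close>.\<close>
      define d where "d = (Re x - c) / 2"
      have d: "d > 0" using x by (simp add: d_def)
      have "bounded (C ` cball x d)"
        by (intro compact_imp_bounded compact_continuous_image continuous_on_subset[OF C]) auto
      then obtain B where B: "\<forall>y \<in> cball x d. \<bar>C y\<bar> \<le> B"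
        unfolding bounded_iff by auto
      have B0: "B \<ge> 0" using bspec[OF B, of x] d by auto
      define h where "h = (\<lambda>j. B * (real j + 1) powr (- (d + 1)))"
      have "summable (\<lambda>j. real (Suc j) powr (- (d + 1)))"
        using d by (subst summable_Suc_iff) (simp add: summable_real_powr_iff)
      then have h: "summable h"
        unfolding h_def by (intro summable_mult) (simp add: add.commute)
      have "norm (f j y) \<le> h j" if y: "y \<in> ball x d" "y \<in> ?S" for j y
      proof -
        have "\<bar>Re (x - y)\<bar> < d"
          using y abs_Re_le_cmod[of "x - y"] by (auto simp: dist_norm)
        then have "Re y - c \<ge> d" by (simp add: d_def field_simps abs_if split: if_splits)
        then have "(real j + 1) powr (- (Re y - c + 1)) \<le> (real j + 1) powr (- (d + 1))"
          by (intro powr_mono) auto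
        moreover have "C y \<le> B" using bspec[OF B, of y] y by auto
        ultimately have "C y * (real j + 1) powr (- (Re y - c + 1)) \<le> h j"
          unfolding h_def using B0 by (intro mult_mono) auto
        then show ?thesis using bound[of y j] y by auto
      qed
      moreover have "h j \<ge> 0" for j using B0 by (simp add: h_def)
      ultimately show ?thesis using d h
        by (intro exI[of _ d] exI[of _ "\<lambda>j. of_real (h j)"])
           (auto simp: summable_of_real)
    qed
  qed
  show "summable (\<lambda>j. f j s)" if "Re s > c" for s
    using g that sums_summable by blast
  show "(\<lambda>s. \<Sum>j. f j s) holomorphic_on ?S"
  proof (rule holomorphic_transform)
    show "g holomorphic_on ?S"
      using g by (auto simp: holomorphic_on_open[OF S] field_differentiable_def)
    show "g x = (\<Sum>j. f j x)" if "x \<in> ?S" for x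
      using g that sums_unique by blast
  qed
qed

text \<open>
  The remainder is governed by the \<open>(n + 1)\<close>-st derivative, a multiple of \<open>u powr (a - (n + 1))\<close>.
  On the half-plane \<open>Re u \<ge> t\<close>, which is convex and avoids the branch cut, this is largest in size
  at distance \<open>t\<close> from the origin, up to the factor coming from \<open>Im a\<close> and the argument of \<open>u\<close>.
\<close>
lemma norm_powr_Taylor_remainder_le:
  fixes a z :: complex
  assumes "1 \<le> t" "t \<le> Re z" "Re a \<le> real n + 1"
  shows "norm ((z + 1) powr a - (\<Sum>i\<le>n. (a gchoose i) * z powr (a - of_nat i)))
     \<le> norm (\<Prod>i = 0..<Suc n. a - of_nat i) * exp (pi * \<bar>Im a\<bar>) * t powr (Re a - (real n + 1))"
proof -
  define f where "f i u = (\<Prod>l = 0..<i. a - of_nat l) * u powr (a - of_nat i)" for i u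
  let ?S = "{u. Re u \<ge> t}"
  let ?B = "norm (\<Prod>i = 0..<Suc n. a - of_nat i) * exp (pi * \<bar>Im a\<bar>) * t powr (Re a - (real n + 1))"
  have "norm (f 0 (z + 1) - (\<Sum>i\<le>n. f i z * (z + 1 - z) ^ i / fact i))
      \<le> ?B * norm (z + 1 - z) ^ Suc n / fact n"
  proof (rule complex_Taylor)
    show "convex ?S" by (rule convex_halfspace_Re_ge)
    show "(f i has_field_derivative f (Suc i) u) (at u within ?S)" if "u \<in> ?S" for i u
    proof -
      have "u \<notin> \<real>\<^sub>\<le>\<^sub>0" using that assms(1) by (auto simp: complex_nonpos_Reals_iff)
      then show ?thesis unfolding f_def
        by (auto intro!: derivative_eq_intros simp: algebra_simps)
    qed
    show "norm (f (Suc n) u) \<le> ?B" if "u \<in> ?S" for u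
    proof -
      have "norm (u powr (a - of_nat (Suc n))) \<le> t powr (Re a - (real n + 1)) * exp (pi * \<bar>Im a\<bar>)"
        using norm_powr_right_halfplane_le[of t u "a - of_nat (Suc n)"] that assms
        by (simp add: algebra_simps)
      then have "norm (f (Suc n) u) \<le> norm (\<Prod>i = 0..<Suc n. a - of_nat i) *
          (t powr (Re a - (real n + 1)) * exp (pi * \<bar>Im a\<bar>))"
        unfolding f_def norm_mult by (intro mult_left_mono) auto
      then show ?thesis by (simp add: mult_ac)
    qed
  qed (use assms in auto)
  also have "\<dots> \<le> ?B / 1"
    unfolding add_diff_cancel_left' norm_one power_one mult_1_right
    by (intro divide_left_mono mult_nonneg_nonneg) auto
  finally show ?thesis
    by (simp add: f_def gbinomial_prod_rev)
qed

section \<open>The recurrence for the Hurwitz series\<close>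

definition hurwitz_series :: "complex \<Rightarrow> complex \<Rightarrow> complex" where
  "hurwitz_series v s = (\<Sum>j. (of_nat j + v) powr (- s))"

lemma
  assumes v: "Re v \<ge> 1"
  shows holomorphic_hurwitz_series: "hurwitz_series v holomorphic_on {s. Re s > 1}"
    and sums_hurwitz_series:
      "Re s > 1 \<Longrightarrow> (\<lambda>j. (of_nat j + v) powr (- s)) sums hurwitz_series v s"
proof -
  have *: "(\<lambda>s. (of_nat j + v) powr (- s)) holomorphic_on {s. 1 < Re s}" for j :: nat
    by (intro holomorphic_intros)
  have **: "continuous_on UNIV (\<lambda>s. exp (pi * \<bar>Im s\<bar>))"
    by (intro continuous_intros)
  have ***: "norm ((of_nat j + v) powr (- s)) \<le> exp (pi * \<bar>Im s\<bar>) * (real j + 1) powr (- (Re s - 1 + 1))"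
    if "1 < Re s" for j s
    using norm_powr_right_halfplane_le[of "real j + 1" "of_nat j + v" "- s"] that v
    by (simp add: mult.commute)
  note H = holomorphic_dominated_series[OF * ** ***]
  show "hurwitz_series v holomorphic_on {s. Re s > 1}"
    unfolding hurwitz_series_def[abs_def] by (rule H(1))
  show "(\<lambda>j. (of_nat j + v) powr (- s)) sums hurwitz_series v s" if "Re s > 1"
    unfolding hurwitz_series_def by (intro summable_sums H(2) that)
qed

definition Taylor_remainder :: "nat \<Rightarrow> complex \<Rightarrow> complex \<Rightarrow> complex" where
  "Taylor_remainder n z s =
     (z + 1) powr (1 - s) - (\<Sum>i\<le>n. ((1 - s) gchoose i) * z powr (1 - s - of_nat i))"

lemma holomorphic_gbinomial [holomorphic_intros]:
  "f holomorphic_on A \<Longrightarrow> (\<lambda>s. f s gchoose k) holomorphic_on A" for f :: "complex \<Rightarrow> complex"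
  unfolding gbinomial_prod_rev by (intro holomorphic_intros) auto

text \<open>
  The remainder of order \<open>n\<close> at \<open>j + v\<close> decays like \<open>j\<close> to the power \<open>- Re s - n\<close>, so convergence for
  \<open>Re s > -M\<close> takes the order \<open>n = M + 1\<close>.
\<close>
lemma
  assumes v: "Re v \<ge> 1"
  shows holomorphic_sum_Taylor_remainder:
      "(\<lambda>s. \<Sum>j. Taylor_remainder (Suc M) (of_nat j + v) s) holomorphic_on {s. Re s > - real M}"
    and summable_Taylor_remainder:
      "Re s > - real M \<Longrightarrow> summable (\<lambda>j. Taylor_remainder (Suc M) (of_nat j + v) s)"
proof -
  have *: "Taylor_remainder (Suc M) (of_nat j + v) holomorphic_on {s. - real M < Re s}" for j
    unfolding Taylor_remainder_def by (intro holomorphic_intros)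
  have **: "continuous_on UNIV
      (\<lambda>s. norm (\<Prod>i = 0..<Suc (Suc M). 1 - s - of_nat i) * exp (pi * \<bar>Im s\<bar>))"
    by (intro continuous_intros)
  have ***: "norm (Taylor_remainder (Suc M) (of_nat j + v) s) \<le>
       norm (\<Prod>i = 0..<Suc (Suc M). 1 - s - of_nat i) * exp (pi * \<bar>Im s\<bar>)
         * (real j + 1) powr (- (Re s - - real M + 1))"
    if "- real M < Re s" for j s
  proof -
    have e: "Re (1 - s) - (real (Suc M) + 1) = - (Re s - - real M + 1)" by simp
    show ?thesis
      using norm_powr_Taylor_remainder_le[of "real j + 1" "of_nat j + v" "1 - s" "Suc M"] that v
      unfolding Taylor_remainder_def e by simp
  qed
  note H = holomorphic_dominated_series[OF * ** ***]
  show "(\<lambda>s. \<Sum>j. Taylor_remainder (Suc M) (of_nat j + v) s) holomorphic_on {s. Re s > - real M}"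
    by (rule H(1))
  show "summable (\<lambda>j. Taylor_remainder (Suc M) (of_nat j + v) s)" if "Re s > - real M"
    by (intro H(2) that)
qed

lemma powr_shift_tendsto_0:
  fixes v b :: complex
  assumes "Re v \<ge> 1" "Re b < 0"
  shows "(\<lambda>j. (of_nat j + v) powr b) \<longlonglongrightarrow> 0"
proof (rule Lim_null_comparison)
  show "\<forall>\<^sub>F j in sequentially. norm ((of_nat j + v) powr b)
      \<le> (real j + 1) powr Re b * exp (pi * \<bar>Im b\<bar>)"
    using assms by (intro always_eventually allI norm_powr_right_halfplane_le) auto
  have "(\<lambda>j. real (Suc j) powr Re b) \<longlonglongrightarrow> 0"
    using assms(2) by (intro LIMSEQ_Suc tendsto_neg_powr filterlim_real_sequentially)
  then have "(\<lambda>j. (real j + 1) powr Re b) \<longlonglongrightarrow> 0"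
    by (simp add: add.commute)
  then show "(\<lambda>j. (real j + 1) powr Re b * exp (pi * \<bar>Im b\<bar>)) \<longlonglongrightarrow> 0"
    by (rule tendsto_mult_left_zero)
qed

text \<open>
  Summing the Taylor expansions over \<open>j\<close> turns the left-hand sides minus the terms of order 0 into a
  telescoping series with value \<open>- v powr (1 - s)\<close>, while the terms of order \<open>i + 1\<close> add up to a
  multiple of the series at \<open>s + i\<close>; the one with \<open>i = 0\<close> is solved for. The factor \<open>s + i - 1\<close>
  split off from the binomial coefficient of order \<open>i + 1\<close> cancels the pole that the
  continued series has at \<open>s + i = 1\<close>. So the function \<open>(s - 1) * hurwitz_series v s\<close> satisfies a
  recurrence in which its own values to the right carry coefficients polynomial in \<open>s\<close>.
\<close>
lemma hurwitz_series_recurrence: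
  assumes v: "Re v \<ge> 1" and s: "Re s > 1"
  shows "(s - 1) * hurwitz_series v s =
     (\<Sum>j. Taylor_remainder (Suc M) (of_nat j + v) s) + v powr (1 - s)
     - (\<Sum>i=1..M. ((1 - s) gchoose i) / of_nat (Suc i)
           * ((s + of_nat i - 1) * hurwitz_series v (s + of_nat i)))"
proof -
  let ?Z = "hurwitz_series v"
  have "(\<lambda>j. (of_nat (Suc j) + v) powr (1 - s) - (of_nat j + v) powr (1 - s)) sums
      (0 - (of_nat 0 + v) powr (1 - s))"
    using v s by (intro telescope_sums powr_shift_tendsto_0) auto
  moreover have "(\<lambda>j. \<Sum>i=0..M. ((1 - s) gchoose Suc i) * (of_nat j + v) powr (- (s + of_nat i)))
      sums (\<Sum>i=0..M. ((1 - s) gchoose Suc i) * ?Z (s + of_nat i))"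
    using s v by (intro sums_sum sums_mult sums_hurwitz_series) auto
  ultimately have "(\<lambda>j. (of_nat (Suc j) + v) powr (1 - s) - (of_nat j + v) powr (1 - s)
      - (\<Sum>i=0..M. ((1 - s) gchoose Suc i) * (of_nat j + v) powr (- (s + of_nat i)))) sums
      (0 - (of_nat 0 + v) powr (1 - s) - (\<Sum>i=0..M. ((1 - s) gchoose Suc i) * ?Z (s + of_nat i)))"
    by (rule sums_diff)
  also have "(\<lambda>j. (of_nat (Suc j) + v) powr (1 - s) - (of_nat j + v) powr (1 - s)
      - (\<Sum>i=0..M. ((1 - s) gchoose Suc i) * (of_nat j + v) powr (- (s + of_nat i))))
      = (\<lambda>j. Taylor_remainder (Suc M) (of_nat j + v) s)"
    unfolding Taylor_remainder_def atMost_atLeast0 sum.atLeast0_atMost_Suc_shift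
    by (simp add: algebra_simps)
  finally have R: "(\<Sum>j. Taylor_remainder (Suc M) (of_nat j + v) s) =
      - (v powr (1 - s)) - (\<Sum>i=0..M. ((1 - s) gchoose Suc i) * ?Z (s + of_nat i))"
    by (simp add: sums_iff)
  have "(\<Sum>i=0..M. ((1 - s) gchoose Suc i) * ?Z (s + of_nat i)) =
     (1 - s) * ?Z s + (\<Sum>i=1..M. ((1 - s) gchoose Suc i) * ?Z (s + of_nat i))"
    by (subst sum.atLeast_Suc_atMost) auto
  also have "(\<Sum>i=1..M. ((1 - s) gchoose Suc i) * ?Z (s + of_nat i)) =
      - (\<Sum>i=1..M. ((1 - s) gchoose i) / of_nat (Suc i) * ((s + of_nat i - 1) * ?Z (s + of_nat i)))"
  proof -
    have "((1 - s) gchoose Suc i) = - (((1 - s) gchoose i) / of_nat (Suc i) * (s + of_nat i - 1))" for i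
      using gbinomial_mult_1[of "1 - s" i] by (simp add: field_simps del: of_nat_Suc)
    then show ?thesis
      by (simp add: sum_negf mult.assoc)
  qed
  finally show ?thesis
    unfolding R by (simp add: algebra_simps)
qed

section \<open>Analytic continuation\<close>

text \<open>
  The right-hand side of the recurrence uses values at \<open>s + 1, \<dots>, s + M\<close> only, so an extension to
  \<open>Re s > 1 - M\<close> makes it meaningful and holomorphic for \<open>Re s > -M\<close>.
\<close>
lemma hurwitz_series_extends_to_halfplane:
  assumes v: "Re v \<ge> 1"
  shows "\<exists>g. g holomorphic_on {s. Re s > 1 - real M} \<and>
     (\<forall>s. Re s > 1 \<longrightarrow> g s = (s - 1) * hurwitz_series v s)"
proof (induction M)
  case 0
  show ?case
    by (rule exI[of _ "\<lambda>s. (s - 1) * hurwitz_series v s"])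
       (auto intro!: holomorphic_intros holomorphic_hurwitz_series v)
next
  case (Suc M)
  then obtain g where g: "g holomorphic_on {s. Re s > 1 - real M}"
    and gZ: "\<And>s. Re s > 1 \<Longrightarrow> g s = (s - 1) * hurwitz_series v s"
    by blast
  have shift: "(\<lambda>s. g (s + of_nat i)) holomorphic_on {s. Re s > - real M}" if "i \<in> {1..M}" for i
    using that by (intro holomorphic_on_compose_gen[OF _ g, unfolded o_def] holomorphic_intros) auto
  show ?case
  proof (intro exI[of _ "\<lambda>s. (\<Sum>j. Taylor_remainder (Suc M) (of_nat j + v) s) + v powr (1 - s)
     - (\<Sum>i=1..M. ((1 - s) gchoose i) / of_nat (Suc i) * g (s + of_nat i))"] conjI allI impI)
    have e: "{s. Re s > 1 - real (Suc M)} = {s. Re s > - real M}" by simp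
    show "(\<lambda>s. (\<Sum>j. Taylor_remainder (Suc M) (of_nat j + v) s) + v powr (1 - s)
     - (\<Sum>i=1..M. ((1 - s) gchoose i) / of_nat (Suc i) * g (s + of_nat i)))
      holomorphic_on {s. Re s > 1 - real (Suc M)}"
      unfolding e by (intro holomorphic_intros holomorphic_sum_Taylor_remainder[OF v] shift)
        (auto simp del: of_nat_Suc)
  next
    fix s assume s: "Re s > 1"
    have "(\<Sum>i=1..M. ((1 - s) gchoose i) / of_nat (Suc i) * g (s + of_nat i)) =
       (\<Sum>i=1..M. ((1 - s) gchoose i) / of_nat (Suc i)
           * ((s + of_nat i - 1) * hurwitz_series v (s + of_nat i)))"
      using s by (intro sum.cong refl) (simp add: gZ)
    then show "(\<Sum>j. Taylor_remainder (Suc M) (of_nat j + v) s) + v powr (1 - s)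
       - (\<Sum>i=1..M. ((1 - s) gchoose i) / of_nat (Suc i) * g (s + of_nat i))
       = (s - 1) * hurwitz_series v s"
      by (simp only: hurwitz_series_recurrence[OF v s, of M])
  qed
qed

text \<open>
  The extensions agree on common half-planes by the identity theorem, so they glue.
\<close>
lemma entire_extension_of_halfplane_extensions:
  assumes "\<And>M::nat. \<exists>g. g holomorphic_on {s. Re s > 1 - real M} \<and> (\<forall>s. Re s > 1 \<longrightarrow> g s = h s)"
  obtains g where "g holomorphic_on UNIV" "\<And>s. Re s > 1 \<Longrightarrow> g s = h s"
proof -
  obtain G where G: "\<And>M::nat. G M holomorphic_on {s. Re s > 1 - real M}"
    and Gh: "\<And>M s. Re s > 1 \<Longrightarrow> G M s = h s"
    using assms by metis
  have agree: "G M s = G N s" if "M \<le> N" "Re s > 1 - real M" for M N s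
  proof (rule analytic_continuation_open[where f = "G M" and g = "G N"
        and s = "{s. Re s > 1}" and s' = "{s. Re s > 1 - real M}"])
    show "{s. Re s > 1} \<noteq> {}" by (auto intro!: exI[of _ 2])
    show "connected {s. Re s > 1 - real M}"
      by (intro convex_connected convex_halfspace_Re_gt)
    show "G N holomorphic_on {s. Re s > 1 - real M}"
      using that by (intro holomorphic_on_subset[OF G]) auto
    show "open {s. Re s > 1}" "open {s. Re s > 1 - real M}"
      by (rule open_halfspace_Re_gt)+
    show "{s. Re s > 1} \<subseteq> {s. Re s > 1 - real M}" by auto
    show "G M holomorphic_on {s. Re s > 1 - real M}" by (rule G)
    show "s \<in> {s. Re s > 1 - real M}" using that by simp
    show "G M w = G N w" if "w \<in> {s. Re s > 1}" for w
      using that by (simp add: Gh)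
  qed
  \<comment> \<open>Any half-plane of the family that contains \<open>s\<close> would do.\<close>
  define idx where "idx s = nat \<lceil>2 - Re s\<rceil>" for s
  have idx: "Re s > 1 - real (idx s)" for s
    unfolding idx_def by linarith
  define g where "g s = G (idx s) s" for s
  have gG: "g s = G M s" if "Re s > 1 - real M" for M s
    using agree[of M "idx s" s] agree[of "idx s" M s] that idx[of s] unfolding g_def
    by (metis nat_le_linear)
  show thesis
  proof
    show "g holomorphic_on UNIV"
      unfolding holomorphic_on_def
    proof
      fix s :: complex
      let ?S = "{w. Re w > 1 - real (idx s)}"
      have "g holomorphic_on ?S"
        by (rule holomorphic_transform[OF G]) (simp add: gG)
      then show "g field_differentiable (at s)"
        using holomorphic_on_imp_differentiable_at[of g ?S s] idx open_halfspace_Re_gt by auto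
    qed
    show "g s = h s" if "Re s > 1" for s
      using gG[of 0 s] Gh[of s 0] that by simp
  qed
qed

text \<open>
  The index shift \<open>m\<close> moves \<open>v\<close> to \<open>Re v \<ge> 1\<close>. The \<open>m\<close> terms left out are entire in \<open>w\<close>, also
  when some \<open>j + v\<close> vanishes, since \<open>0 powr (- w) = 0\<close> for all \<open>w\<close>.
\<close>
lemma hurwitz_continuation_exists:
  obtains f where "f holomorphic_on (- {1})"
    and "\<And>w. Re w > 1 \<Longrightarrow> (\<lambda>j. (of_nat j + v) powr (- w)) sums f w"
proof -
  define m where "m = nat \<lceil>1 - Re v\<rceil>"
  have v: "Re (of_nat m + v) \<ge> 1"
    unfolding m_def by simp linarith
  obtain g where g: "g holomorphic_on UNIV"
    and gZ: "\<And>s. Re s > 1 \<Longrightarrow> g s = (s - 1) * hurwitz_series (of_nat m + v) s"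
    using entire_extension_of_halfplane_extensions[OF hurwitz_series_extends_to_halfplane[OF v]]
    by blast
  show thesis
  proof
    show "(\<lambda>s. g s / (s - 1) + (\<Sum>j<m. (of_nat j + v) powr (- s))) holomorphic_on (- {1})"
      by (intro holomorphic_intros holomorphic_on_subset[OF g]) auto
    fix w :: complex
    assume w: "Re w > 1"
    then have "w \<noteq> 1" by auto
    then have "g w / (w - 1) = hurwitz_series (of_nat m + v) w" using gZ[OF w] by simp
    then have "(\<lambda>j. (of_nat (j + m) + v) powr (- w)) sums (g w / (w - 1))"
      using sums_hurwitz_series[OF v w] by (simp add: add.assoc)
    then show "(\<lambda>j. (of_nat j + v) powr (- w)) sums
        (g w / (w - 1) + (\<Sum>j<m. (of_nat j + v) powr (- w)))"
      by (subst (asm) sums_iff_shift) simp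
  qed
qed

section \<open>Duplication and telescoping\<close>

text \<open>
  In the region of convergence the two series on the left consist of the terms of even and of odd
  index of the series for \<open>v\<close>, scaled by \<open>2 powr s\<close>. The principal power splits off the positive
  factor 2 for every base, so branch cuts cause no correction.
\<close>
lemma hurwitz_zeta_duplication:
  assumes s: "s \<noteq> 1"
  shows "hurwitz_zeta s (v / 2) + hurwitz_zeta s ((v + 1) / 2) = 2 powr s * hurwitz_zeta s v"
proof -
  obtain f where f: "f holomorphic_on (- {1})"
    "\<And>w. Re w > 1 \<Longrightarrow> (\<lambda>j. (of_nat j + v / 2) powr (- w)) sums f w"
    by (rule hurwitz_continuation_exists[of "v / 2"], rule that)
  obtain g where g: "g holomorphic_on (- {1})"
    "\<And>w. Re w > 1 \<Longrightarrow> (\<lambda>j. (of_nat j + (v + 1) / 2) powr (- w)) sums g w"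
    by (rule hurwitz_continuation_exists[of "(v + 1) / 2"], rule that)
  obtain h where h: "\<And>w. Re w > 1 \<Longrightarrow> (\<lambda>j. (of_nat j + v) powr (- w)) sums h w"
    by (rule hurwitz_continuation_exists[of v], rule that)
  have "hurwitz_zeta s v = 2 powr (- s) * (f s + g s)"
  proof (rule hurwitz_zeta_eqI[OF _ _ s])
    show "(\<lambda>w. 2 powr (- w) * (f w + g w)) holomorphic_on (- {1})"
      by (intro holomorphic_intros f g)
    fix w :: complex
    assume w: "Re w > 1"
    have two: "2 powr (- w) * (u powr (- w)) = (2 * u) powr (- w)" for u :: complex
      by (rule powr_times_real_left[symmetric]) auto
    have "(\<lambda>n. \<Sum>j = n * 2..<n * 2 + 2. (of_nat j + v) powr (- w)) sums h w"
      by (intro sums_group h w) auto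
    also have "(\<lambda>n. \<Sum>j = n * 2..<n * 2 + 2. (of_nat j + v) powr (- w)) =
        (\<lambda>n. 2 powr (- w) * ((of_nat n + v / 2) powr (- w) + (of_nat n + (v + 1) / 2) powr (- w)))"
    proof
      fix n :: nat
      have "{n * 2..<n * 2 + 2} = {2 * n, 2 * n + 1}" by auto
      moreover have "2 * (of_nat n + v / 2) = of_nat (2 * n) + v"
        "2 * (of_nat n + (v + 1) / 2) = of_nat (2 * n + 1) + v" by (simp_all add: distrib_left)
      ultimately show "(\<Sum>j = n * 2..<n * 2 + 2. (of_nat j + v) powr (- w)) =
          2 powr (- w) * ((of_nat n + v / 2) powr (- w) + (of_nat n + (v + 1) / 2) powr (- w))"
        by (simp only: distrib_left[of "2 powr (- w)"] two) simp
    qed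
    finally have "h w = 2 powr (- w) * (f w + g w)"
      using sums_mult[OF sums_add[OF f(2)[OF w] g(2)[OF w]], of "2 powr (- w)"]
      by (rule sums_unique2)
    then show "(\<lambda>j. (of_nat j + v) powr (- w)) sums (2 powr (- w) * (f w + g w))"
      using h[OF w] by simp
  qed
  moreover have "hurwitz_zeta s (v / 2) = f s" "hurwitz_zeta s ((v + 1) / 2) = g s"
    using hurwitz_zeta_eqI[OF f s] hurwitz_zeta_eqI[OF g s] by auto
  moreover have "2 powr s * (2 powr (- s) * x) = x" for x :: complex
    by (simp add: powr_minus)
  ultimately show ?thesis by simp
qed

theorem theorem4p114:
  fixes n :: nat and k a :: complex
  assumes "n > 0" and "a \<noteq> 0" and "k \<noteq> -1"
    and "\<And>p. p < n \<Longrightarrow> (of_real pi + 3 * \<i> * 2 ^ p * ln a) / (6 * of_real pi) \<notin> \<int>\<^sub>\<le>\<^sub>0"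
    and "\<And>p. p < n \<Longrightarrow> 1 / 6 * (5 + 3 * \<i> * 2 ^ p * ln a / of_real pi) \<notin> \<int>\<^sub>\<le>\<^sub>0"
    and "1 / 3 + \<i> * ln a / (2 * of_real pi) \<notin> \<int>\<^sub>\<le>\<^sub>0"
    and "2 / 3 + \<i> * ln a / (2 * of_real pi) \<notin> \<int>\<^sub>\<le>\<^sub>0"
    and "1 / 6 * (2 + 3 * \<i> * 2 ^ n * ln a / of_real pi) \<notin> \<int>\<^sub>\<le>\<^sub>0"
    and "1 / 6 * (4 + 3 * \<i> * 2 ^ n * ln a / of_real pi) \<notin> \<int>\<^sub>\<le>\<^sub>0"
  shows
    "- (\<Sum>p = 0..n - 1. (- \<i> * 2 powi (- int p)) powr k *
          (hurwitz_zeta (- k) ((of_real pi + 3 * \<i> * 2 ^ p * ln a) / (6 * of_real pi)) +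
           hurwitz_zeta (- k) (1 / 6 * (5 + 3 * \<i> * 2 ^ p * ln a / of_real pi)))) =
     exp (- (1 / 2) * \<i> * k * of_real pi) *
          (hurwitz_zeta (- k) (1 / 3 + \<i> * ln a / (2 * of_real pi)) +
           hurwitz_zeta (- k) (2 / 3 + \<i> * ln a / (2 * of_real pi))) -
     (- \<i> * 2 powi (- int n)) powr k *
          (hurwitz_zeta (- k) (1 / 6 * (2 + 3 * \<i> * 2 ^ n * ln a / of_real pi)) +
           hurwitz_zeta (- k) (1 / 6 * (4 + 3 * \<i> * 2 ^ n * ln a / of_real pi)))"
proof -
  define x where "x p = \<i> * 2 ^ p * ln a / (2 * of_real pi)" for p :: nat
  define G where "G p = hurwitz_zeta (- k) (1 / 3 + x p) + hurwitz_zeta (- k) (2 / 3 + x p)" for p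
  define H where "H p = hurwitz_zeta (- k) (1 / 6 + x p) + hurwitz_zeta (- k) (5 / 6 + x p)" for p
  define c where "c p = (- \<i> * 2 powi (- int p)) powr k" for p :: nat
  have k: "- k \<noteq> 1" using \<open>k \<noteq> -1\<close> by (metis minus_minus)
  have GH: "G p + H p = 2 powr (- k) * G (Suc p)" for p
  proof -
    have e: "(1 / 3 + x (Suc p)) / 2 = 1 / 6 + x p" "(1 / 3 + x (Suc p) + 1) / 2 = 2 / 3 + x p"
      "(2 / 3 + x (Suc p)) / 2 = 1 / 3 + x p" "(2 / 3 + x (Suc p) + 1) / 2 = 5 / 6 + x p"
      by (simp_all add: x_def field_simps)
    have "G p + H p =
        (hurwitz_zeta (- k) (1 / 6 + x p) + hurwitz_zeta (- k) (2 / 3 + x p)) +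
        (hurwitz_zeta (- k) (1 / 3 + x p) + hurwitz_zeta (- k) (5 / 6 + x p))"
      by (simp add: G_def H_def)
    also have "\<dots> = 2 powr (- k) * G (Suc p)"
      using hurwitz_zeta_duplication[OF k, of "1 / 3 + x (Suc p)"]
        hurwitz_zeta_duplication[OF k, of "2 / 3 + x (Suc p)"]
      unfolding e G_def by (simp only: distrib_left)
    finally show ?thesis .
  qed
  have c_Suc: "c (Suc p) = c p * 2 powr (- k)" for p
  proof -
    \<comment> \<open>As in the duplication formula, a positive factor may be taken out of a principal power.\<close>
    have e: "- \<i> * 2 powi (- int p) = 2 * (- \<i> * 2 powi (- int (Suc p)))"
      by (simp add: power_int_minus field_simps del: of_nat_Suc)
    have "c p = 2 powr k * c (Suc p)"
      unfolding c_def e by (rule powr_times_real_left) auto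
    then show ?thesis by (simp add: powr_minus)
  qed
  have c_0: "c 0 = exp (- (1 / 2) * \<i> * k * of_real pi)"
    by (simp add: c_def powr_def mult_ac)
  have "(\<Sum>p = 0..n - 1. c p * H p) = (\<Sum>p<n. c (Suc p) * G (Suc p) - c p * G p)"
  proof (rule sum.cong)
    show "{0..n - 1} = {..<n}" using \<open>n > 0\<close> by auto
    show "c p * H p = c (Suc p) * G (Suc p) - c p * G p" for p
    proof -
      have "H p = 2 powr (- k) * G (Suc p) - G p"
        using GH[of p] by (simp add: eq_diff_eq add.commute)
      then show ?thesis by (simp only: c_Suc right_diff_distrib mult.assoc)
    qed
  qed
  also have "\<dots> = c n * G n - c 0 * G 0"
    by (rule sum_lessThan_telescope)
  finally have main: "- (\<Sum>p = 0..n - 1. c p * H p) = c 0 * G 0 - c n * G n" by simp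
  have "(of_real pi + 3 * \<i> * 2 ^ p * ln a) / (6 * of_real pi) = 1 / 6 + x p"
    "1 / 6 * (5 + 3 * \<i> * 2 ^ p * ln a / of_real pi) = 5 / 6 + x p"
    "1 / 6 * (2 + 3 * \<i> * 2 ^ p * ln a / of_real pi) = 1 / 3 + x p"
    "1 / 6 * (4 + 3 * \<i> * 2 ^ p * ln a / of_real pi) = 2 / 3 + x p"
    "\<i> * ln a / (2 * of_real pi) = x 0" for p
    by (simp_all add: x_def field_simps)
  then show ?thesis
    using main unfolding c_0 by (simp only: G_def H_def c_def)
qed

end
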